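(* For every $D>0$ there is a continuous probability distribution $\mu_D$ supported on the interval $[D,2D]$ such that every 4-robust schedule $X$ satisfies $c(X,\mu_D)\ge 4\ln 2$.
   Context: A (contract) schedule is an increasing bi-infinite sequence $X=(x_i)_{i\in\mathbb{Z}}$ of positive reals with $\sum_{j\le i}x_j<\infty$; contracts are executed consecutively and contract $i$ completes at time $\sum_{j\le i}x_j$. For $T>0$, $\ell(X,T)$ is the largest length $x_i$ of a contract completed by time $T$. The robustness of $X$ is $\sup_{T>0}T/\ell(X,T)$; $X$ is $r$-robust if this is at most $r$. The consistency of $X$ with respect to a distribution $\mu$ on $(0,\infty)$ is $c(X,\mu)=\mathbb{E}_{z\sim\mu}[z]\,/\,\mathbb{E}_{z\sim\mu}[\ell(X,z)]$. *)

theory Defs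
  imports "HOL-Probability.Probability"
begin

definition schedule :: "(int \<Rightarrow> real) \<Rightarrow> bool" where
  "schedule X \<longleftrightarrow> strict_mono X \<and> (\<forall>i. X i > 0) \<and> (\<forall>i. X summable_on {..i})"

definition completion_time :: "(int \<Rightarrow> real) \<Rightarrow> int \<Rightarrow> real" where
  "completion_time X i = (\<Sum>\<^sub>\<infinity>j\<in>{..i}. X j)"

text \<open>For a schedule and \<open>T > 0\<close> the maximum exists: completion times tend to \<open>0\<close>
  as \<open>i \<rightarrow> -\<infinity>\<close> and to \<open>\<infinity>\<close> as \<open>i \<rightarrow> \<infinity>\<close>.\<close>

definition largest_completed :: "(int \<Rightarrow> real) \<Rightarrow> real \<Rightarrow> real" where
  "largest_completed X T = (GREATEST x. \<exists>i. x = X i \<and> completion_time X i \<le> T)"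

text \<open>The supremum is taken in the extended reals, so that it is \<open>\<infinity>\<close> when the ratios
  are unbounded.\<close>

definition robustness :: "(int \<Rightarrow> real) \<Rightarrow> ereal" where
  "robustness X = (SUP T\<in>{0<..}. ereal (T / largest_completed X T))"

definition robust :: "real \<Rightarrow> (int \<Rightarrow> real) \<Rightarrow> bool" where
  "robust r X \<longleftrightarrow> robustness X \<le> ereal r"

text \<open>Both expectations are Bochner integrals, hence meaningful when \<open>\<mu>\<close> has finite mean;
  this holds for every distribution concentrated on a bounded interval.\<close>

definition consistency :: "(int \<Rightarrow> real) \<Rightarrow> real measure \<Rightarrow> real" where
  "consistency X \<mu> = (LINT z|\<mu>. z) / (LINT z|\<mu>. largest_completed X z)"

text \<open>Continuous in the sense of having a probability density function with respect to
  Lebesgue measure, which in particular excludes atoms.\<close>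

definition continuous_distribution :: "real measure \<Rightarrow> bool" where
  "continuous_distribution \<mu> \<longleftrightarrow> real_distribution \<mu> \<and>
     (\<exists>f :: real \<Rightarrow> real. f \<in> borel_measurable lborel \<and> (\<forall>x. f x \<ge> 0) \<and>
        \<mu> = density lborel (\<lambda>x. ennreal (f x)))"

end

theory Submission
  imports Defs
begin

text \<open>
  Let \<open>S i\<close> be the completion times of a 4-robust schedule. Letting \<open>T\<close> increase to \<open>S (i + 1)\<close>
  gives \<open>S (i + 1) \<le> 4 (S i - S (i - 1))\<close>, which says that \<open>i \<mapsto> S i / 2 ^ i\<close> is concave. A
  positive concave function on the integers is constant, so \<open>S i = c 2 ^ i\<close>: up to scaling, the
  doubling schedule is the only 4-robust one. Exactly one completion time \<open>t\<close> lies in \<open>(D, 2D]\<close>,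
  and the expected performance is \<open>t (2 - F t) / 4\<close>, where \<open>F\<close> is the distribution function of
  \<open>\<mu>\<close>. The choice \<open>F t = 2 - 2D / t\<close>, with density \<open>2D / t\<^sup>2\<close>, makes it equal to \<open>D / 2\<close> for every
  \<open>t\<close>, while the mean is \<open>2D ln 2\<close>.
\<close>

section \<open>Positive concave sequences on the integers\<close>

lemma strict_mono_intI:
  fixes f :: "int \<Rightarrow> 'a :: order"
  assumes "\<And>i. f i < f (i + 1)"
  shows "strict_mono f"
proof (rule strict_monoI)
  fix i j :: int
  assume "i < j"
  then show "f i < f j"
  proof (induction j rule: int_gr_induct)
    case base
    show ?case by (rule assms)
  next
    case (step j)
    then show ?case using assms less_trans by blast
  qed
qed

lemma int_lift_antimono_le:
  fixes f :: "int \<Rightarrow> 'a :: order"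
  assumes "\<And>i. f (i + 1) \<le> f i" and "i \<le> j"
  shows "f j \<le> f i"
  using assms(2)
proof (induction j rule: int_ge_induct)
  case base
  show ?case by simp
next
  case (step j)
  then show ?case using assms(1) order_trans by blast
qed

text \<open>Increments decrease, so one nonzero increment puts \<open>u\<close> below a line: a
  negative one forces \<open>u\<close> below zero far to the right, a positive one far to the left.
  Both directions are needed; on the naturals such a sequence may increase.\<close>

lemma concave_positive_int_constant:
  fixes u :: "int \<Rightarrow> real"
  assumes pos: "\<And>i. 0 < u i"
    and concave: "\<And>i. u (i + 1) - u i \<le> u i - u (i - 1)"
  shows "u i = u 0"
proof -
  define d where "d i = u (i + 1) - u i" for i
  have d_step: "d (i + 1) \<le> d i" for i
    using concave[of "i + 1"] by (simp add: d_def)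
  have d_anti: "d j \<le> d i" if "i \<le> j" for i j
    using int_lift_antimono_le[of d, OF d_step that] .
  have d_zero: "d i = 0" for i
  proof (rule ccontr)
    assume "d i \<noteq> 0"
    then consider "d i < 0" | "d i > 0" by linarith
    then show False
    proof cases
      case 1
      have bound: "u (i + int n) \<le> u i + real n * d i" for n
      proof (induction n)
        case (Suc n)
        have "u (i + int (Suc n)) = u (i + int n) + d (i + int n)"
          by (simp add: d_def algebra_simps)
        also have "\<dots> \<le> u i + real n * d i + d i"
          using Suc d_anti[of i "i + int n"] by simp
        finally show ?case by (simp add: algebra_simps)
      qed simp
      obtain n :: nat where "u i < real n * (- d i)"
        using reals_Archimedean3[of "- d i"] 1 by auto
      then show False using bound[of n] pos[of "i + int n"] by simp
    next
      case 2
      have bound: "u (i - int n) \<le> u i - real n * d i" for n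
      proof (induction n)
        case (Suc n)
        have "u (i - int (Suc n)) = u (i - int n) - d (i - int (Suc n))"
          by (simp add: d_def algebra_simps)
        also have "\<dots> \<le> u i - real n * d i - d i"
          using Suc d_anti[of "i - int (Suc n)" i] by simp
        finally show ?case by (simp add: algebra_simps)
      qed simp
      obtain n :: nat where "u i < real n * d i"
        using reals_Archimedean3[of "d i"] 2 by auto
      then show False using bound[of n] pos[of "i - int n"] by simp
    qed
  qed
  have step: "u (i + 1) = u i" for i
    using d_zero[of i] by (simp add: d_def)
  show ?thesis
  proof (induction i rule: int_induct[where k = 0])
    case (step1 i)
    then show ?case using step by simp
  next
    case (step2 i)
    then show ?case using step[of "i - 1"] by simp
  qed simp
qed

section \<open>Completion times of schedules\<close>

lemma completion_time_rec:
  assumes "schedule X"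
  shows "completion_time X i = completion_time X (i - 1) + X i"
proof -
  have "{..i} = insert i {..i - 1}" by auto
  moreover have "X summable_on {..i - 1}" using assms by (simp add: schedule_def)
  ultimately show ?thesis
    by (simp add: completion_time_def infsum_insert)
qed

lemma completion_time_pos:
  assumes "schedule X"
  shows "0 < completion_time X i"
proof -
  have X: "0 < X j" for j using assms by (simp add: schedule_def)
  have "0 \<le> completion_time X (i - 1)"
    unfolding completion_time_def by (intro infsum_nonneg) (use X less_imp_le in blast)
  then show ?thesis using completion_time_rec[OF assms, of i] X[of i] by simp
qed

lemma strict_mono_completion_time:
  assumes "schedule X"
  shows "strict_mono (completion_time X)"
proof (rule strict_mono_intI)
  fix i
  show "completion_time X i < completion_time X (i + 1)"
    using assms completion_time_rec[OF assms, of "i + 1"] by (simp add: schedule_def)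
qed

text \<open>Lengths increase with the index, so the longest completed contract is the last completed
  one.\<close>

lemma largest_completed_eq:
  assumes "schedule X" "completion_time X i \<le> T" "T < completion_time X (i + 1)"
  shows "largest_completed X T = X i"
  unfolding largest_completed_def
proof (rule Greatest_equality)
  show "\<exists>j. X i = X j \<and> completion_time X j \<le> T" using assms(2) by blast
next
  fix y assume "\<exists>j. y = X j \<and> completion_time X j \<le> T"
  then obtain j where j: "y = X j" "completion_time X j \<le> T" by blast
  then have "completion_time X j < completion_time X (i + 1)" using assms(3) by simp
  then have "j \<le> i"
    using strict_mono_less[OF strict_mono_completion_time[OF assms(1)]] by simp
  then show "y \<le> X i"
    using j(1) assms(1) by (simp add: schedule_def strict_mono_less_eq)
qed

text \<open>The ratio is worst just before a completion: until contract \<open>i + 1\<close>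
  completes, the largest completed length stays \<open>X i\<close>. At the completion time itself it
  jumps, so the bound there is a limit of the bounds at earlier \<open>T\<close>.\<close>

lemma robust_completion_time_le:
  assumes "schedule X" "robust r X"
  shows "completion_time X (i + 1) \<le> r * X i"
proof (rule dense_le_bounded)
  show "completion_time X i < completion_time X (i + 1)"
    using strict_mono_completion_time[OF assms(1)] by (simp add: strict_mono_less)
next
  fix T assume T: "completion_time X i < T" "T < completion_time X (i + 1)"
  then have "0 < T" using completion_time_pos[OF assms(1), of i] by simp
  then have "ereal (T / largest_completed X T) \<le> robustness X"
    unfolding robustness_def by (intro SUP_upper) simp
  also have "\<dots> \<le> ereal r" using assms(2) by (simp add: robust_def)
  finally have "T / X i \<le> r"
    using largest_completed_eq[OF assms(1), of i T] T by simp
  moreover have "0 < X i" using assms(1) by (simp add: schedule_def)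
  ultimately show "T \<le> r * X i" by (simp add: divide_le_eq)
qed

text \<open>The recurrence behind \<open>S (i + 1) - 4 * S i + 4 * S (i - 1) \<le> 0\<close> has the
  double characteristic root 2. Dividing by the powers of 2 therefore leaves exactly a second
  difference.\<close>

lemma robust_4_completion_time:
  assumes "schedule X" "robust 4 X"
  shows "completion_time X i = completion_time X 0 * 2 powr real_of_int i"
proof -
  define S where "S = completion_time X"
  define u where "u i = S i / 2 powr real_of_int i" for i
  have "u i = u 0"
  proof (rule concave_positive_int_constant)
    show "0 < u i" for i
      using completion_time_pos[OF assms(1)] by (simp add: u_def S_def)
    show "u (i + 1) - u i \<le> u i - u (i - 1)" for i
    proof -
      have "S (i + 1) \<le> 4 * (S i - S (i - 1))"
        using robust_completion_time_le[OF assms, of i] completion_time_rec[OF assms(1), of i]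
        by (simp add: S_def)
      moreover define p where "p = 2 powr real_of_int i"
      have "p > 0" by (simp add: p_def)
      moreover have "u (i + 1) = S (i + 1) / (2 * p)" "u (i - 1) = S (i - 1) / (p / 2)" "u i = S i / p"
        by (simp_all add: u_def p_def powr_add powr_diff)
      \<comment> \<open>The left side is \<open>S (i + 1) / 2 + 2 * S (i - 1)\<close>, the right
        side \<open>2 * S i\<close>.\<close>
      ultimately have "p * (u (i + 1) + u (i - 1)) \<le> p * (2 * u i)"
        by (simp add: distrib_left)
      then show ?thesis using \<open>p > 0\<close> by simp
    qed
  qed
  then show ?thesis by (simp add: u_def S_def field_simps)
qed

section \<open>Performance of 4-robust schedules on a doubling interval\<close>

lemma ex_powr_2_between:
  fixes c D :: real
  assumes "c > 0" "D > 0"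
  shows "\<exists>k::int. D < c * 2 powr real_of_int k \<and> c * 2 powr real_of_int k \<le> 2 * D"
proof -
  \<comment> \<open>The largest exponent whose term is at most \<open>2 * D\<close>; the next term
    exceeds \<open>2 * D\<close>, so this one exceeds \<open>D\<close>.\<close>
  define k where "k = \<lfloor>log 2 (2 * D / c)\<rfloor>"
  have "2 powr real_of_int k \<le> 2 powr log 2 (2 * D / c)"
    by (simp add: k_def)
  moreover have "2 powr log 2 (2 * D / c) < 2 powr (real_of_int k + 1)"
    by (simp add: k_def)
  moreover have "2 powr log 2 (2 * D / c) = 2 * D / c"
    using assms by simp
  ultimately have "2 powr real_of_int k \<le> 2 * D / c" "D / c < 2 powr real_of_int k"
    by (simp_all add: powr_add)
  then show ?thesis using assms by (intro exI[of _ k]) (simp add: field_simps)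
qed

text \<open>A contract completed at time \<open>s\<close> has length \<open>s / 2\<close>. Around
  the interval the completion times are \<open>t / 2 \<le> D\<close>, then \<open>t\<close>, then
  \<open>2 * t > 2 * D\<close>, so the only jump after \<open>D\<close> is at
  \<open>t\<close>.\<close>

lemma robust_4_largest_completed:
  assumes "schedule X" "robust 4 X" "D > 0"
  shows "\<exists>t. D < t \<and> t \<le> 2 * D \<and>
    (\<forall>z\<in>{D..2 * D}. largest_completed X z = (if z < t then t / 4 else t / 2))"
proof -
  define S where "S = completion_time X"
  have S: "S i = S 0 * 2 powr real_of_int i" for i
    unfolding S_def by (rule robust_4_completion_time[OF assms(1,2)])
  have "S 0 > 0" using completion_time_pos[OF assms(1)] by (simp add: S_def)
  then obtain k where k: "D < S k" "S k \<le> 2 * D"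
    using ex_powr_2_between[OF _ assms(3), of "S 0"] by (auto simp flip: S)
  have Sk: "S (k + 1) = 2 * S k" "S (k - 1) = S k / 2" "S (k - 2) = S k / 4"
    using S[of k] S[of "k + 1"] S[of "k - 1"] S[of "k - 2"] by (simp_all add: powr_add powr_diff)
  have X: "X i = S i - S (i - 1)" for i
    using completion_time_rec[OF assms(1), of i] by (simp add: S_def)
  have "largest_completed X z = S k / 4" if "z \<in> {D..2 * D}" "z < S k" for z
    using largest_completed_eq[OF assms(1), of "k - 1" z] that k Sk X[of "k - 1"]
    by (simp add: S_def[symmetric])
  moreover have "largest_completed X z = S k / 2" if "z \<in> {D..2 * D}" "\<not> z < S k" for z
    using largest_completed_eq[OF assms(1), of k z] that k Sk X[of k]
    by (simp add: S_def[symmetric])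
  ultimately show ?thesis using k by (intro exI[of _ "S k"]) auto
qed

text \<open>Measurability matters because the Bochner integral of a non-measurable function is \<open>0\<close>.\<close>

lemma robust_4_largest_completed_measurable:
  assumes "schedule X" "robust 4 X"
  shows "largest_completed X \<in> borel_measurable borel"
proof -
  define c where "c = completion_time X 0"
  \<comment> \<open>For nonpositive \<open>z\<close> no contract is completed and
    \<open>GREATEST\<close> yields an unspecified value. It is the same for all such
    \<open>z\<close>, so the value at 0 serves for all of them.\<close>
  define h where "h z = (if 0 < z then c / 2 * 2 powr real_of_int \<lfloor>log 2 (z / c)\<rfloor>
    else largest_completed X 0)" for z
  have "c > 0" using completion_time_pos[OF assms(1)] by (simp add: c_def)
  have S: "completion_time X i = c * 2 powr real_of_int i" for i
    unfolding c_def by (rule robust_4_completion_time[OF assms])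
  have "largest_completed X z = h z" for z
  proof (cases "0 < z")
    case True
    define k where "k = \<lfloor>log 2 (z / c)\<rfloor>"
    have "2 powr real_of_int k \<le> 2 powr log 2 (z / c)"
      by (simp add: k_def)
    moreover have "2 powr log 2 (z / c) < 2 powr (real_of_int k + 1)"
      by (simp add: k_def)
    moreover have "2 powr log 2 (z / c) = z / c"
      using True \<open>c > 0\<close> by simp
    ultimately have "completion_time X k \<le> z" "z < completion_time X (k + 1)"
      using \<open>c > 0\<close> by (simp_all add: S field_simps)
    then have "largest_completed X z = X k" by (rule largest_completed_eq[OF assms(1)])
    also have "\<dots> = c / 2 * 2 powr real_of_int k"
      using completion_time_rec[OF assms(1), of k] by (simp add: S powr_diff)
    finally show ?thesis using True by (simp add: h_def k_def)
  next
    case False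
    then have "\<not> completion_time X i \<le> z" "\<not> completion_time X i \<le> 0" for i
      using completion_time_pos[OF assms(1), of i] by auto
    then show ?thesis using False by (simp add: h_def largest_completed_def)
  qed
  moreover have "h \<in> borel_measurable borel"
    unfolding h_def[abs_def] by measurable
  ultimately show ?thesis by presburger
qed

section \<open>The inverse-square distribution\<close>

text \<open>For \<open>D > 0\<close> this is the density of \<open>D / U\<close> with
  \<open>U\<close> uniform on [1/2, 1].\<close>

definition inverse_square_density :: "real \<Rightarrow> real \<Rightarrow> real" where
  "inverse_square_density D x = 2 * D / x\<^sup>2 * indicator {D..2 * D} x"

lemma inverse_square_density_measurable [measurable]:
  "inverse_square_density D \<in> borel_measurable borel"
  unfolding inverse_square_density_def[abs_def] by measurable

lemma inverse_square_density_nonneg: "D > 0 \<Longrightarrow> 0 \<le> inverse_square_density D x"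
  by (simp add: inverse_square_density_def)

lemma has_bochner_integral_inverse_square:
  fixes D a b :: real
  assumes "0 < D" "0 < a" "a \<le> b"
  shows "has_bochner_integral lborel (\<lambda>x. 2 * D / x\<^sup>2 * indicator {a..b} x) (2 * D / a - 2 * D / b)"
proof -
  have "has_bochner_integral lborel (\<lambda>x. 2 * D / x\<^sup>2 * indicator {a..b} x) (- 2 * D / b - (- 2 * D / a))"
  proof (rule has_bochner_integral_FTC_Icc_nonneg[where F = "\<lambda>x. - 2 * D / x" and f = "\<lambda>x. 2 * D / x\<^sup>2"])
    fix x assume "x \<in> {a..b}"
    then show "((\<lambda>x. - 2 * D / x) has_real_derivative 2 * D / x\<^sup>2) (at x)"
      using assms by (auto intro!: derivative_eq_intros simp: power2_eq_square)
  qed (use assms in auto)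
  then show ?thesis by simp
qed

lemma has_bochner_integral_inverse:
  fixes D a b :: real
  assumes "0 < D" "0 < a" "a \<le> b"
  shows "has_bochner_integral lborel (\<lambda>x. 2 * D / x * indicator {a..b} x) (2 * D * ln b - 2 * D * ln a)"
proof (rule has_bochner_integral_FTC_Icc_nonneg[where F = "\<lambda>x. 2 * D * ln x" and f = "\<lambda>x. 2 * D / x"])
  fix x assume "x \<in> {a..b}"
  then show "((\<lambda>x. 2 * D * ln x) has_real_derivative 2 * D / x) (at x)"
    using assms by (auto intro!: derivative_eq_intros)
qed (use assms in auto)

lemma inverse_square_density_mass:
  assumes "D > 0"
  shows "has_bochner_integral lborel (inverse_square_density D) 1"
  using has_bochner_integral_inverse_square[of D D "2 * D"] assms
  by (simp add: inverse_square_density_def[abs_def])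

lemma inverse_square_density_mean:
  assumes "D > 0"
  shows "(LINT z|density lborel (\<lambda>x. ennreal (inverse_square_density D x)). z) = 2 * D * ln 2"
proof -
  have "(LINT z|density lborel (\<lambda>x. ennreal (inverse_square_density D x)). z) =
      (LINT z|lborel. inverse_square_density D z * z)"
    by (subst integral_density) (simp_all add: inverse_square_density_nonneg assms)
  also have "\<dots> = (LINT z|lborel. 2 * D / z * indicator {D..2 * D} z)"
    by (intro Bochner_Integration.integral_cong)
      (auto simp: inverse_square_density_def power2_eq_square)
  also have "\<dots> = 2 * D * ln (2 * D) - 2 * D * ln D"
    using has_bochner_integral_inverse[of D D "2 * D"] assms
    by (intro has_bochner_integral_integral_eq) simp
  also have "\<dots> = 2 * D * ln 2" using assms by (simp add: ln_mult algebra_simps)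
  finally show ?thesis .
qed

text \<open>The mass of \<open>{D..t}\<close> is \<open>2 - 2 * D / t\<close>, and
  \<open>t / 2 - t / 4 * (2 - 2 * D / t) = D / 2\<close>: the jump point cancels.\<close>

lemma inverse_square_density_step:
  assumes "D < t" "t \<le> 2 * D" "D > 0"
    and g: "\<And>z. z \<in> {D..2 * D} \<Longrightarrow> g z = (if z < t then t / 4 else t / 2)"
  shows "has_bochner_integral lborel (\<lambda>z. inverse_square_density D z * g z) (D / 2)"
proof -
  \<comment> \<open>The step function is \<open>t / 2\<close> on the whole interval, lowered by
    \<open>t / 4\<close> up to \<open>t\<close>.\<close>
  let ?h = "\<lambda>z. t / 2 * (2 * D / z\<^sup>2 * indicator {D..2 * D} z) - t / 4 * (2 * D / z\<^sup>2 * indicator {D..t} z)"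
  have "has_bochner_integral lborel ?h
      (t / 2 * (2 * D / D - 2 * D / (2 * D)) - t / 4 * (2 * D / D - 2 * D / t))"
    using assms(1-3)
    by (intro has_bochner_integral_diff has_bochner_integral_mult_right
        has_bochner_integral_inverse_square) auto
  also have "t / 2 * (2 * D / D - 2 * D / (2 * D)) - t / 4 * (2 * D / D - 2 * D / t) = D / 2"
    using assms(1-3) by (simp add: field_simps)
  finally have h: "has_bochner_integral lborel ?h (D / 2)" .
  \<comment> \<open>\<open>g\<close> is known only on the interval; since the density vanishes
    elsewhere, the product is still an explicit measurable function.\<close>
  have eq: "inverse_square_density D z * g z =
      inverse_square_density D z * (if z < t then t / 4 else t / 2)" for z
    using g[of z] by (cases "z \<in> {D..2 * D}") (auto simp: inverse_square_density_def)
  \<comment> \<open>At \<open>t\<close> itself \<open>g\<close> has already jumped while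
    \<open>?h\<close> still subtracts, so the two sides agree only off this null set.\<close>
  have "AE z in lborel. z \<noteq> t" by (rule AE_lborel_singleton)
  then have "AE z in lborel. ?h z = inverse_square_density D z * g z"
    by eventually_elim
      (use assms(1-3) in \<open>auto simp: g inverse_square_density_def split: split_indicator\<close>)
  moreover have "(\<lambda>z. inverse_square_density D z * g z) \<in> borel_measurable lborel"
    unfolding eq by measurable
  ultimately show ?thesis
    using h has_bochner_integral_cong_AE[of ?h lborel "\<lambda>z. inverse_square_density D z * g z"]
    by simp
qed

theorem theorem3:
  fixes D :: real
  assumes "D > 0"
  shows "\<exists>\<mu> :: real measure. continuous_distribution \<mu> \<and> measure \<mu> {D..2 * D} = 1 \<and>
    (\<forall>X. schedule X \<and> robust 4 X \<longrightarrow> consistency X \<mu> \<ge> 4 * ln 2)"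
proof (intro exI conjI allI impI)
  let ?f = "inverse_square_density D"
  let ?\<mu> = "density lborel (\<lambda>x. ennreal (?f x))"
  have f_nonneg: "0 \<le> ?f x" for x
    by (rule inverse_square_density_nonneg[OF assms])
  have mass: "(\<integral>\<^sup>+x. ennreal (?f x) \<partial>lborel) = 1"
    using inverse_square_density_mass[OF assms] f_nonneg
    by (subst nn_integral_eq_integral) (auto simp: has_bochner_integral_iff)
  interpret prob_space ?\<mu>
    by (rule prob_spaceI) (simp add: emeasure_density mass)
  show "continuous_distribution ?\<mu>"
    unfolding continuous_distribution_def real_distribution_def real_distribution_axioms_def
    using prob_space_axioms f_nonneg by (auto intro!: exI[of _ ?f])
  have "emeasure ?\<mu> {D..2 * D} = (\<integral>\<^sup>+x. ennreal (?f x) * indicator {D..2 * D} x \<partial>lborel)"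
    by (simp add: emeasure_density)
  also have "\<dots> = (\<integral>\<^sup>+x. ennreal (?f x) \<partial>lborel)"
    by (intro nn_integral_cong) (auto simp: inverse_square_density_def split: split_indicator)
  finally show "measure ?\<mu> {D..2 * D} = 1"
    by (simp add: mass measure_def)
  fix X assume "schedule X \<and> robust 4 X"
  then have X: "schedule X" "robust 4 X" by auto
  obtain t where t: "D < t" "t \<le> 2 * D"
    "\<And>z. z \<in> {D..2 * D} \<Longrightarrow> largest_completed X z = (if z < t then t / 4 else t / 2)"
    using robust_4_largest_completed[OF X assms] by blast
  have "(LINT z|?\<mu>. largest_completed X z) = (LINT z|lborel. ?f z * largest_completed X z)"
    using robust_4_largest_completed_measurable[OF X] f_nonneg
    by (subst integral_density) simp_all
  also have "\<dots> = D / 2"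
    using inverse_square_density_step[OF t(1,2) assms t(3)]
    by (rule has_bochner_integral_integral_eq)
  finally have "(LINT z|?\<mu>. largest_completed X z) = D / 2" .
  \<comment> \<open>Equality holds: \<open>2 * D * ln 2\<close> divided by \<open>D / 2\<close> is
    \<open>4 * ln 2\<close>.\<close>
  then show "4 * ln 2 \<le> consistency X ?\<mu>"
    unfolding consistency_def using assms by (simp only: inverse_square_density_mean) simp
qed

end
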